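(* Let $G$ be a locally compact Hausdorff topological groupoid with range map $r$ and domain map $d$. Define binary operations on $S_G$ and $S'_G$ by $$(f\ast g)(x)=g\big(f(x)x\big)f(x)\qquad (f,g\in S_G,\ x\in G),$$ $$(h\star k)(x)=h(x)\,k\big(xh(x)\big)\qquad (h,k\in S'_G,\ x\in G).$$ Then $(S_G,\ast)$ and $(S'_G,\star)$ are monoids, and they are isomorphic to each other as monoids. The map $r:G\to G$ is the identity element of $S_G$, and the map $d:G\to G$ is the identity element of $S'_G$.
   Context: A groupoid $G$ has a partially defined product $(x,y)\mapsto xy$ on the set $G^2\subset G\times G$ of composable pairs, and an inverse map $x\mapsto x^{-1}$. Put $r(x)=xx^{-1}$ and $d(x)=x^{-1}x$; a pair $(x,y)$ is composable if and only if $d(x)=r(y)$. The unit space is $G^0=r(G)=d(G)$, and for $u\in G^0$, $G^u=r^{-1}(u)$ and $G_u=d^{-1}(u)$. A topological groupoid is a groupoid with a topology for which the inverse map and the product map $G^2\to G$ ($G^2$ with the topology induced from $G\times G$) are continuous; topologies are assumed locally compact and Hausdorff. $C(G,G)$ is the set of continuous maps from $G$ to $G$. Define $$S_G=\{f\in C(G,G): f(x)\in G_{r(x)}\text{ for all }x\in G\},$$ $$S'_G=\{f\in C(G,G): f(x)\in G^{d(x)}\text{ for all }x\in G\}.$$ A monoid is a semigroup with identity. *)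

theory Defs
  imports "HOL-Analysis.Analysis" "HOL-Algebra.Group"
begin

record 'a groupoid = "'a partial_object" +
  composable :: "('a \<times> 'a) set"
  gmult :: "'a \<Rightarrow> 'a \<Rightarrow> 'a"
  ginv :: "'a \<Rightarrow> 'a"

text \<open>The product is a total HOL function, but only its values on composable pairs matter; all
  axioms are relative to the carrier.\<close>

locale groupoid =
  fixes G :: "('a, 'b) groupoid_scheme"
  assumes composable_subset: "composable G \<subseteq> carrier G \<times> carrier G"
    and gmult_closed: "(x, y) \<in> composable G \<Longrightarrow> gmult G x y \<in> carrier G"
    and ginv_closed: "x \<in> carrier G \<Longrightarrow> ginv G x \<in> carrier G"
    and ginv_ginv: "x \<in> carrier G \<Longrightarrow> ginv G (ginv G x) = x"
    and composable_left:
      "(x, y) \<in> composable G \<Longrightarrow> (y, z) \<in> composable G \<Longrightarrow> (gmult G x y, z) \<in> composable G"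
    and composable_right:
      "(x, y) \<in> composable G \<Longrightarrow> (y, z) \<in> composable G \<Longrightarrow> (x, gmult G y z) \<in> composable G"
    and gmult_assoc:
      "(x, y) \<in> composable G \<Longrightarrow> (y, z) \<in> composable G \<Longrightarrow>
        gmult G (gmult G x y) z = gmult G x (gmult G y z)"
    and composable_ginv_left: "x \<in> carrier G \<Longrightarrow> (ginv G x, x) \<in> composable G"
    and composable_ginv_right: "x \<in> carrier G \<Longrightarrow> (x, ginv G x) \<in> composable G"
    and ginv_gmult_cancel:
      "(x, y) \<in> composable G \<Longrightarrow> gmult G (ginv G x) (gmult G x y) = y"
    and gmult_ginv_cancel:
      "(z, x) \<in> composable G \<Longrightarrow> gmult G (gmult G z x) (ginv G x) = z"

definition grange :: "('a, 'b) groupoid_scheme \<Rightarrow> 'a \<Rightarrow> 'a" where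
  "grange G x = gmult G x (ginv G x)"

definition gdomain :: "('a, 'b) groupoid_scheme \<Rightarrow> 'a \<Rightarrow> 'a" where
  "gdomain G x = gmult G (ginv G x) x"

lemma (in groupoid) composable_iff:
  assumes x: "x \<in> carrier G" and y: "y \<in> carrier G"
  shows "(x, y) \<in> composable G \<longleftrightarrow> gdomain G x = grange G y"
proof
  assume xy: "(x, y) \<in> composable G"
  have "gmult G x (grange G y) = x"
    using gmult_assoc[OF xy composable_ginv_right[OF y]] gmult_ginv_cancel[OF xy]
    by (simp add: grange_def)
  moreover have "(x, grange G y) \<in> composable G"
    using composable_right[OF xy composable_ginv_right[OF y]] by (simp add: grange_def)
  ultimately show "gdomain G x = grange G y"
    using ginv_gmult_cancel by (fastforce simp: gdomain_def)
next
  assume eq: "gdomain G x = grange G y"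
  have "(x, grange G y) \<in> composable G"
    using composable_right[OF composable_ginv_right[OF x] composable_ginv_left[OF x]] eq
    by (simp add: gdomain_def)
  moreover have "(grange G y, y) \<in> composable G"
    using composable_left[OF composable_ginv_right[OF y] composable_ginv_left[OF y]]
    by (simp add: grange_def)
  moreover have "gmult G (grange G y) y = y"
    using gmult_ginv_cancel[OF composable_ginv_right[OF y]] ginv_ginv[OF y]
    by (simp add: grange_def)
  ultimately show "(x, y) \<in> composable G"
    using composable_right by fastforce
qed

definition range_fibre :: "('a, 'b) groupoid_scheme \<Rightarrow> 'a \<Rightarrow> 'a set" where
  "range_fibre G u = {x \<in> carrier G. grange G x = u}"

definition domain_fibre :: "('a, 'b) groupoid_scheme \<Rightarrow> 'a \<Rightarrow> 'a set" where
  "domain_fibre G u = {x \<in> carrier G. gdomain G x = u}"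

locale topological_groupoid = groupoid G for G :: "('a, 'b) groupoid_scheme" +
  fixes T :: "'a topology"
  assumes topspace_eq: "topspace T = carrier G"
    and continuous_ginv: "continuous_map T T (ginv G)"
    and continuous_gmult:
      "continuous_map (subtopology (prod_topology T T) (composable G)) T (\<lambda>(x, y). gmult G x y)"

text \<open>Continuous self-maps are required to be \<^const>\<open>extensional\<close>, so that HOL equality of two
  maps means that they agree on the space.\<close>

definition continuous_self_maps :: "'a topology \<Rightarrow> ('a \<Rightarrow> 'a) set" where
  "continuous_self_maps T = {f \<in> extensional (topspace T). continuous_map T T f}"

definition S_set :: "('a, 'b) groupoid_scheme \<Rightarrow> 'a topology \<Rightarrow> ('a \<Rightarrow> 'a) set" where
  "S_set G T =
    {f \<in> continuous_self_maps T. \<forall>x\<in>carrier G. f x \<in> domain_fibre G (grange G x)}"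

definition S'_set :: "('a, 'b) groupoid_scheme \<Rightarrow> 'a topology \<Rightarrow> ('a \<Rightarrow> 'a) set" where
  "S'_set G T =
    {f \<in> continuous_self_maps T. \<forall>x\<in>carrier G. f x \<in> range_fibre G (gdomain G x)}"

definition S_monoid :: "('a, 'b) groupoid_scheme \<Rightarrow> 'a topology \<Rightarrow> ('a \<Rightarrow> 'a) monoid" where
  "S_monoid G T =
    \<lparr>carrier = S_set G T,
     mult = (\<lambda>f g. \<lambda>x\<in>carrier G. gmult G (g (gmult G (f x) x)) (f x)),
     one = (\<lambda>x\<in>carrier G. grange G x)\<rparr>"

definition S'_monoid :: "('a, 'b) groupoid_scheme \<Rightarrow> 'a topology \<Rightarrow> ('a \<Rightarrow> 'a) monoid" where
  "S'_monoid G T =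
    \<lparr>carrier = S'_set G T,
     mult = (\<lambda>h k. \<lambda>x\<in>carrier G. gmult G (h x) (k (gmult G x (h x)))),
     one = (\<lambda>x\<in>carrier G. gdomain G x)\<rparr>"

end

theory Submission imports Defs
begin

text \<open>An element \<open>f\<close> of \<open>S\<close> is a continuous choice of an arrow \<open>f x\<close> that can be multiplied onto
  \<open>x\<close> from the left, and so it amounts to the map \<open>x \<mapsto> f x \<cdot> x\<close>, left translation by \<open>f\<close>. The
  product \<open>f \<otimes> g\<close> is the choice whose translation is that of \<open>f\<close> followed by that of \<open>g\<close>:
  \<open>(f \<otimes> g) x \<cdot> x = g (f x \<cdot> x) \<cdot> (f x \<cdot> x)\<close>. Composition of translations is associative, and
  choosing the unit \<open>r x\<close> gives the identity translation; the monoid laws of \<open>S\<close> are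
  these facts with the trailing \<open>x\<close> cancelled (\<open>S_mult_assoc\<close>, \<open>monoid_S\<close>). The product of two
  continuous choices is again continuous because the product of \<open>G\<close> is continuous on composable
  pairs (\<open>continuous_map_gmult\<close>).

  Elements of \<open>S'\<close> act by right translation in the same way. Inversion of arrows
  interchanges the left and the right side, and therefore conjugation by inversion,
  \<open>f \<mapsto> (x \<mapsto> (f (x\<inverse>))\<inverse>)\<close>, exchanges \<open>S\<close> and \<open>S'\<close>. It is an involution and turns one product into
  the other (\<open>ginv_conj_mult\<close>), so it is an isomorphism, and the monoid laws of \<open>S'\<close> are transported
  along it (\<open>monoid_S'\<close>).\<close>

section \<open>Arrow calculus in a groupoid\<close>

context groupoid
begin

lemma composable_closed:
  assumes "(x, y) \<in> composable G"
  shows "x \<in> carrier G" "y \<in> carrier G"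
  using assms composable_subset by auto

lemma grange_ginv: "x \<in> carrier G \<Longrightarrow> grange G (ginv G x) = gdomain G x"
  by (simp add: grange_def gdomain_def ginv_ginv)

lemma gdomain_ginv: "x \<in> carrier G \<Longrightarrow> gdomain G (ginv G x) = grange G x"
  by (simp add: grange_def gdomain_def ginv_ginv)

lemma grange_closed: "x \<in> carrier G \<Longrightarrow> grange G x \<in> carrier G"
  by (simp add: grange_def composable_ginv_right gmult_closed)

lemma composable_grange: "x \<in> carrier G \<Longrightarrow> (grange G x, x) \<in> composable G"
  unfolding grange_def
  by (blast intro: composable_left composable_ginv_left composable_ginv_right)

lemma grange_gmult_self: "x \<in> carrier G \<Longrightarrow> gmult G (grange G x) x = x"
  using gmult_ginv_cancel[OF composable_ginv_right, of x] by (simp add: grange_def ginv_ginv)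

lemma gmult_gdomain_self: "x \<in> carrier G \<Longrightarrow> gmult G x (gdomain G x) = x"
  using ginv_gmult_cancel[OF composable_ginv_left, of x] by (simp add: gdomain_def ginv_ginv)

lemma grange_gmult:
  assumes "(x, y) \<in> composable G"
  shows "grange G (gmult G x y) = grange G x"
proof -
  have x: "x \<in> carrier G" using assms by (rule composable_closed)
  have "(ginv G x, gmult G x y) \<in> composable G"
    by (rule composable_right[OF composable_ginv_left[OF x] assms])
  then have "gdomain G (ginv G x) = grange G (gmult G x y)"
    using x assms by (simp add: composable_iff gmult_closed ginv_closed)
  with x show ?thesis by (simp add: gdomain_ginv)
qed

lemma gdomain_gmult:
  assumes "(x, y) \<in> composable G"
  shows "gdomain G (gmult G x y) = gdomain G y"
proof -
  have y: "y \<in> carrier G" using assms by (rule composable_closed)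
  have "(gmult G x y, ginv G y) \<in> composable G"
    by (rule composable_left[OF assms composable_ginv_right[OF y]])
  then have "gdomain G (gmult G x y) = grange G (ginv G y)"
    using y assms by (simp add: composable_iff gmult_closed ginv_closed)
  with y show ?thesis by (simp add: grange_ginv)
qed

lemma gdomain_grange: "x \<in> carrier G \<Longrightarrow> gdomain G (grange G x) = grange G x"
  using composable_grange composable_iff grange_closed by blast

lemma composable_ginv_ginv:
  assumes "(x, y) \<in> composable G"
  shows "(ginv G y, ginv G x) \<in> composable G"
  using assms composable_closed[OF assms]
  by (simp add: composable_iff ginv_closed grange_ginv gdomain_ginv)

text \<open>The candidate \<open>q = y\<inverse> x\<inverse>\<close> satisfies \<open>(x y) q = r x\<close>, which is the unit at the domain of
  \<open>(x y)\<inverse>\<close>; multiplying by \<open>(x y)\<inverse>\<close> from the left then gives \<open>q = (x y)\<inverse>\<close>.\<close>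

lemma ginv_gmult:
  assumes xy: "(x, y) \<in> composable G"
  shows "ginv G (gmult G x y) = gmult G (ginv G y) (ginv G x)"
proof -
  let ?p = "gmult G x y" and ?q = "gmult G (ginv G y) (ginv G x)"
  have x: "x \<in> carrier G" and y: "y \<in> carrier G" using xy by (rule composable_closed)+
  have p: "?p \<in> carrier G" using xy by (rule gmult_closed)
  have yx: "(ginv G y, ginv G x) \<in> composable G" using xy by (rule composable_ginv_ginv)
  have py: "(?p, ginv G y) \<in> composable G"
    by (rule composable_left[OF xy composable_ginv_right[OF y]])
  have "gmult G ?p ?q = gmult G (gmult G ?p (ginv G y)) (ginv G x)"
    using gmult_assoc[OF py yx] by simp
  also have "\<dots> = grange G x"
    using gmult_ginv_cancel[OF xy] by (simp add: grange_def)
  also have "\<dots> = gdomain G (ginv G ?p)"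
    using p by (simp add: gdomain_ginv grange_gmult[OF xy])
  finally have pq: "gmult G ?p ?q = gdomain G (ginv G ?p)" .
  have "?q = gmult G (ginv G ?p) (gmult G ?p ?q)"
    by (rule ginv_gmult_cancel[OF composable_right[OF py yx], symmetric])
  then show ?thesis
    using gmult_gdomain_self[OF ginv_closed[OF p]] by (simp add: pq)
qed

end

section \<open>The monoid of left translations\<close>

context topological_groupoid
begin

lemma continuous_map_carrier:
  assumes "continuous_map T T f" "x \<in> carrier G"
  shows "f x \<in> carrier G"
  using assms continuous_map_image_subset_topspace topspace_eq by blast

text \<open>The product of \<open>G\<close> is continuous only on composable pairs, so composability at every point is
  what allows it to be composed with \<open>x \<mapsto> (f x, g x)\<close>.\<close>

lemma continuous_map_gmult:
  assumes "continuous_map T T f" "continuous_map T T g"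
    and "\<And>x. x \<in> carrier G \<Longrightarrow> (f x, g x) \<in> composable G"
  shows "continuous_map T T (\<lambda>x. gmult G (f x) (g x))"
proof -
  have "continuous_map T (subtopology (prod_topology T T) (composable G)) (\<lambda>x. (f x, g x))"
    using assms by (auto simp: continuous_map_in_subtopology continuous_map_pairedI topspace_eq)
  from continuous_map_compose[OF this continuous_gmult] show ?thesis
    by (simp add: o_def)
qed

lemma restrict_in_continuous_self_maps:
  assumes "continuous_map T T f"
  shows "restrict f (carrier G) \<in> continuous_self_maps T"
  using assms by (auto simp: continuous_self_maps_def topspace_eq elim: continuous_map_eq)

lemma S_setI:
  assumes "continuous_map T T f" "\<And>x. x \<in> carrier G \<Longrightarrow> gdomain G (f x) = grange G x"
  shows "restrict f (carrier G) \<in> S_set G T"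
  using assms
  by (auto simp: S_set_def domain_fibre_def restrict_in_continuous_self_maps continuous_map_carrier)

lemma S'_setI:
  assumes "continuous_map T T f" "\<And>x. x \<in> carrier G \<Longrightarrow> grange G (f x) = gdomain G x"
  shows "restrict f (carrier G) \<in> S'_set G T"
  using assms
  by (auto simp: S'_set_def range_fibre_def restrict_in_continuous_self_maps continuous_map_carrier)

lemma S_setD:
  assumes "f \<in> S_set G T"
  shows "continuous_map T T f" "f \<in> extensional (carrier G)"
    and "x \<in> carrier G \<Longrightarrow> f x \<in> carrier G"
    and "x \<in> carrier G \<Longrightarrow> gdomain G (f x) = grange G x"
    and "x \<in> carrier G \<Longrightarrow> (f x, x) \<in> composable G"
  using assms
  by (auto simp: S_set_def continuous_self_maps_def domain_fibre_def topspace_eq composable_iff)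

lemma S'_setD:
  assumes "h \<in> S'_set G T"
  shows "continuous_map T T h" "h \<in> extensional (carrier G)"
    and "x \<in> carrier G \<Longrightarrow> h x \<in> carrier G"
    and "x \<in> carrier G \<Longrightarrow> grange G (h x) = gdomain G x"
    and "x \<in> carrier G \<Longrightarrow> (x, h x) \<in> composable G"
  using assms
  by (auto simp: S'_set_def continuous_self_maps_def range_fibre_def topspace_eq composable_iff)

lemma S_translate_closed:
  "f \<in> S_set G T \<Longrightarrow> x \<in> carrier G \<Longrightarrow> gmult G (f x) x \<in> carrier G"
  by (simp add: gmult_closed S_setD)

text \<open>Translating \<open>x\<close> by \<open>f\<close> gives an arrow with the same range as \<open>f x\<close>; this is why the two factors
  in the product of \<open>S\<close> fit together.\<close>

lemma S_mult_composable:
  assumes f: "f \<in> S_set G T" and g: "g \<in> S_set G T" and x: "x \<in> carrier G"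
  shows "(g (gmult G (f x) x), f x) \<in> composable G"
  using S_translate_closed[OF f x] S_setD[OF f] S_setD[OF g] x
  by (simp add: composable_iff grange_gmult)

lemma S_mult_closed:
  assumes f: "f \<in> S_set G T" and g: "g \<in> S_set G T"
  shows "f \<otimes>\<^bsub>S_monoid G T\<^esub> g \<in> S_set G T"
proof -
  have "continuous_map T T (\<lambda>x. gmult G (f x) x)"
    using S_setD[OF f] by (intro continuous_map_gmult) auto
  then have "continuous_map T T (\<lambda>x. g (gmult G (f x) x))"
    using continuous_map_compose[OF _ S_setD(1)[OF g]] by (simp add: o_def)
  then have "continuous_map T T (\<lambda>x. gmult G (g (gmult G (f x) x)) (f x))"
    using S_mult_composable[OF f g] S_setD(1)[OF f] by (intro continuous_map_gmult)
  then show ?thesis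
    using S_mult_composable[OF f g] S_setD[OF f]
    by (auto simp: S_monoid_def gdomain_gmult intro!: S_setI)
qed

lemma one_S_closed: "\<one>\<^bsub>S_monoid G T\<^esub> \<in> S_set G T"
proof -
  have "continuous_map T T (\<lambda>x. gmult G x (ginv G x))"
    using continuous_ginv by (intro continuous_map_gmult) (auto simp: composable_ginv_right)
  then have "continuous_map T T (grange G)"
    by (simp add: grange_def[abs_def])
  then show ?thesis
    by (auto simp: S_monoid_def gdomain_grange intro!: S_setI)
qed

text \<open>At \<open>x\<close>, with \<open>y = f x \<cdot> x\<close>, both bracketings are \<open>k (g y \<cdot> y) \<cdot> g y \<cdot> f x\<close>: the argument of
  \<open>k\<close> is \<open>x\<close> translated by \<open>f\<close> and then by \<open>g\<close>.\<close>

lemma S_mult_assoc: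
  assumes f: "f \<in> S_set G T" and g: "g \<in> S_set G T" and k: "k \<in> S_set G T"
  shows "f \<otimes>\<^bsub>S_monoid G T\<^esub> g \<otimes>\<^bsub>S_monoid G T\<^esub> k = f \<otimes>\<^bsub>S_monoid G T\<^esub> (g \<otimes>\<^bsub>S_monoid G T\<^esub> k)"
proof -
  have "gmult G (k (gmult G (gmult G (g (gmult G (f x) x)) (f x)) x))
          (gmult G (g (gmult G (f x) x)) (f x))
      = gmult G (gmult G (k (gmult G (g (gmult G (f x) x)) (gmult G (f x) x)))
          (g (gmult G (f x) x))) (f x)"
    if x: "x \<in> carrier G" for x
  proof -
    let ?y = "gmult G (f x) x"
    have y: "?y \<in> carrier G" by (rule S_translate_closed[OF f x])
    have gf: "(g ?y, f x) \<in> composable G" by (rule S_mult_composable[OF f g x])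
    have kg: "(k (gmult G (g ?y) ?y), g ?y) \<in> composable G" by (rule S_mult_composable[OF g k y])
    have "gmult G (gmult G (g ?y) (f x)) x = gmult G (g ?y) ?y"
      by (rule gmult_assoc[OF gf S_setD(5)[OF f x]])
    with gmult_assoc[OF kg gf] show ?thesis by simp
  qed
  then show ?thesis
    by (auto simp: S_monoid_def S_translate_closed[OF f] intro!: restrict_ext)
qed

lemma monoid_S: "monoid (S_monoid G T)"
proof (rule monoidI, goal_cases)
  case (4 f)
  then have f: "f \<in> S_set G T" by (simp add: S_monoid_def)
  show ?case
  proof (rule extensionalityI)
    fix x assume x: "x \<in> carrier G"
    have "gmult G (f x) (grange G x) = f x"
      using gmult_gdomain_self[OF S_setD(3)[OF f x]] S_setD(4)[OF f x] by simp
    with x show "(\<one>\<^bsub>S_monoid G T\<^esub> \<otimes>\<^bsub>S_monoid G T\<^esub> f) x = f x"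
      by (simp add: S_monoid_def grange_gmult_self)
  qed (use S_setD[OF f] in \<open>auto simp: S_monoid_def\<close>)
next
  case (5 f)
  then have f: "f \<in> S_set G T" by (simp add: S_monoid_def)
  show ?case
  proof (rule extensionalityI)
    fix x assume x: "x \<in> carrier G"
    have "grange G (gmult G (f x) x) = grange G (f x)"
      by (rule grange_gmult[OF S_setD(5)[OF f x]])
    with x show "(f \<otimes>\<^bsub>S_monoid G T\<^esub> \<one>\<^bsub>S_monoid G T\<^esub>) x = f x"
      by (simp add: S_monoid_def S_translate_closed[OF f] grange_gmult_self S_setD(3)[OF f])
  qed (use S_setD[OF f] in \<open>auto simp: S_monoid_def\<close>)
qed (use S_mult_closed one_S_closed S_mult_assoc in \<open>simp_all add: S_monoid_def\<close>)

end

section \<open>Conjugation by inversion\<close>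

definition ginv_conj :: "('a, 'b) groupoid_scheme \<Rightarrow> ('a \<Rightarrow> 'a) \<Rightarrow> 'a \<Rightarrow> 'a" where
  "ginv_conj G f = (\<lambda>x\<in>carrier G. ginv G (f (ginv G x)))"

context topological_groupoid
begin

lemma continuous_map_ginv_conj:
  assumes "continuous_map T T f"
  shows "continuous_map T T (\<lambda>x. ginv G (f (ginv G x)))"
  using continuous_map_compose[OF continuous_map_compose[OF continuous_ginv assms] continuous_ginv]
  by (simp add: o_def)

lemma ginv_conj_in_S': "f \<in> S_set G T \<Longrightarrow> ginv_conj G f \<in> S'_set G T"
  unfolding ginv_conj_def
  by (rule S'_setI) (simp_all add: continuous_map_ginv_conj S_setD ginv_closed grange_ginv)

lemma ginv_conj_in_S: "h \<in> S'_set G T \<Longrightarrow> ginv_conj G h \<in> S_set G T"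
  unfolding ginv_conj_def
  by (rule S_setI) (simp_all add: continuous_map_ginv_conj S'_setD ginv_closed gdomain_ginv)

lemma ginv_conj_involutive:
  assumes "continuous_map T T f" "f \<in> extensional (carrier G)"
  shows "ginv_conj G (ginv_conj G f) = f"
  using assms
  by (intro extensionalityI[of _ "carrier G"])
    (auto simp: ginv_conj_def ginv_closed ginv_ginv continuous_map_carrier)

lemma ginv_conj_bij: "bij_betw (ginv_conj G) (S_set G T) (S'_set G T)"
  by (rule bij_betw_byWitness[where f' = "ginv_conj G"])
    (auto simp: ginv_conj_in_S ginv_conj_in_S' ginv_conj_involutive S_setD S'_setD)

text \<open>Inversion reverses products, so the inverse of \<open>g (f (x\<inverse>) \<cdot> x\<inverse>) \<cdot> f (x\<inverse>)\<close> has the conjugate of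
  \<open>f\<close> as its left factor, and \<open>f (x\<inverse>) \<cdot> x\<inverse>\<close> is the inverse of \<open>x\<close> translated from the right by
  that conjugate.\<close>

lemma ginv_conj_mult:
  assumes f: "f \<in> S_set G T" and g: "g \<in> S_set G T"
  shows "ginv_conj G (f \<otimes>\<^bsub>S_monoid G T\<^esub> g)
    = ginv_conj G f \<otimes>\<^bsub>S'_monoid G T\<^esub> ginv_conj G g"
proof (rule extensionalityI[of _ "carrier G"])
  fix x assume x: "x \<in> carrier G"
  let ?a = "f (ginv G x)"
  have ix: "ginv G x \<in> carrier G" using x by (rule ginv_closed)
  have a: "?a \<in> carrier G" by (rule S_setD(3)[OF f ix])
  have ax: "(?a, ginv G x) \<in> composable G" by (rule S_setD(5)[OF f ix])
  have xa: "(x, ginv G ?a) \<in> composable G"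
    using composable_ginv_ginv[OF ax] by (simp add: ginv_ginv x)
  have "ginv G (gmult G x (ginv G ?a)) = gmult G ?a (ginv G x)"
    using ginv_gmult[OF xa] by (simp add: ginv_ginv a)
  then show "ginv_conj G (f \<otimes>\<^bsub>S_monoid G T\<^esub> g) x
      = (ginv_conj G f \<otimes>\<^bsub>S'_monoid G T\<^esub> ginv_conj G g) x"
    using x ix gmult_closed[OF xa] ginv_gmult[OF S_mult_composable[OF f g ix]]
    by (simp add: ginv_conj_def S_monoid_def S'_monoid_def)
qed (simp_all add: ginv_conj_def S'_monoid_def)

lemma ginv_conj_one: "ginv_conj G \<one>\<^bsub>S_monoid G T\<^esub> = \<one>\<^bsub>S'_monoid G T\<^esub>"
proof -
  have "ginv G (gmult G (ginv G x) x) = gmult G (ginv G x) x" if "x \<in> carrier G" for x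
    using that ginv_gmult[OF composable_ginv_left[OF that]] by (simp add: ginv_ginv)
  then show ?thesis
    by (auto simp: ginv_conj_def S_monoid_def S'_monoid_def grange_def gdomain_def ginv_closed
        ginv_ginv intro!: restrict_ext)
qed

lemma ginv_conj_iso: "ginv_conj G \<in> iso (S_monoid G T) (S'_monoid G T)"
  using ginv_conj_bij ginv_conj_in_S' ginv_conj_mult
  by (auto simp: iso_def hom_def S_monoid_def S'_monoid_def)

lemma monoid_S': "monoid (S'_monoid G T)"
proof -
  have "ginv_conj G ` carrier (S_monoid G T) = carrier (S'_monoid G T)"
    using ginv_conj_bij by (simp add: bij_betw_def S_monoid_def S'_monoid_def)
  with monoid.hom_imp_img_monoid[OF monoid_S] ginv_conj_iso show ?thesis
    by (fastforce simp: iso_def ginv_conj_one)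
qed

end

theorem proposition3p2:
  fixes G :: "('a, 'b) groupoid_scheme" and T :: "'a topology"
  assumes "topological_groupoid G T"
    and "locally_compact_space T"
    and "Hausdorff_space T"
  defines "S \<equiv> S_monoid G T" and "S' \<equiv> S'_monoid G T"
    and "r \<equiv> (\<lambda>x\<in>carrier G. grange G x)" and "d \<equiv> (\<lambda>x\<in>carrier G. gdomain G x)"
  shows "monoid S \<and> monoid S' \<and> S \<cong> S' \<and>
    r \<in> carrier S \<and> \<one>\<^bsub>S\<^esub> = r \<and> (\<forall>f\<in>carrier S. r \<otimes>\<^bsub>S\<^esub> f = f \<and> f \<otimes>\<^bsub>S\<^esub> r = f) \<and>
    d \<in> carrier S' \<and> \<one>\<^bsub>S'\<^esub> = d \<and> (\<forall>h\<in>carrier S'. d \<otimes>\<^bsub>S'\<^esub> h = h \<and> h \<otimes>\<^bsub>S'\<^esub> d = h)"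
proof -
  interpret topological_groupoid G T by fact
  interpret S: monoid S unfolding S_def by (rule monoid_S)
  interpret S': monoid S' unfolding S'_def by (rule monoid_S')
  have "r = \<one>\<^bsub>S\<^esub>" and "d = \<one>\<^bsub>S'\<^esub>"
    by (simp_all add: r_def d_def S_def S'_def S_monoid_def S'_monoid_def)
  moreover have "S \<cong> S'"
    using ginv_conj_iso by (auto simp: is_iso_def S_def S'_def)
  ultimately show ?thesis
    using S.monoid_axioms S'.monoid_axioms by simp
qed

end
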